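(* Let $-3<\gamma\le 1$ and let the collision kernel be $B(v-v_*,\omega)=|v-v_*|^{\gamma}b_\gamma(\theta)$ with $\int_{\mathbb{S}^2_+}b_\gamma(\theta)\,d\omega=B_\gamma<\infty$, where $\theta$ is the angle between $v-v_*$ and $\omega$. Let $\alpha,\beta>0$ and let $a_m,a_M$ be strictly positive constants. Then for every $0<p\le\infty$ there is a constant $G_p$ (depending on $p$ and on the fixed parameters, but not on $x,v,t$) such that the following holds. If $f$ is a mild solution of the Boltzmann equation with initial datum $f_0$ satisfying, for all $t\ge 0$, $$a_m e^{-\alpha|x|^2-\beta|v|^2}\le f(x+tv,v,t)\le a_M e^{-\alpha|x|^2-\beta|v|^2}\qquad\text{for a.e. }(x,v)\in\mathbb{R}^3\times\mathbb{R}^3,$$ then $$\|f(t)\|_{L^p}\le G_p\,\|f_0\|_{L^p}\qquad\text{for all }t\ge 0.$$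
   Context: The Boltzmann equation is $\partial_t f+v\cdot\nabla_x f=Q(f,f)$ for $(x,v,t)\in\mathbb{R}^3\times\mathbb{R}^3\times\mathbb{R}_+$, with $$Q(f,f)(x,v,t)=\frac1\kappa\int_{\mathbb{R}^3\times\mathbb{S}^2_+}B(v-v_*,\omega)\,\big(f(x,v',t)f(x,v_*',t)-f(x,v,t)f(x,v_*,t)\big)\,d\omega\,dv_*,$$ where $\kappa>0$ is a fixed constant (the Knudsen number), $\mathbb{S}^2_+=\{\omega\in\mathbb{S}^2:(v-v_* )\cdot\omega\ge0\}$, and $v'=v-[(v-v_* )\cdot\omega]\omega$, $v_*'=v_*+[(v-v_* )\cdot\omega]\omega$. The function $b_\gamma\ge 0$ is the angular part of the collision kernel. For a function $h(x,v,t)$ write $h^\sharp(x,v,t)=h(x+tv,v,t)$; in particular $Q^\sharp(f,f)(x,v,s)=Q(f,f)(x+sv,v,s)$. A mild solution with initial datum $f_0$ is a nonnegative function $f\in L^\infty(0,T;L^1(\mathbb{R}^3\times\mathbb{R}^3))$ (for every $T>0$) such that $$f^\sharp(x,v,t)=f_0(x,v)+\int_0^tQ^\sharp(f,f)(x,v,s)\,ds,\qquad (x,v,t)\in\mathbb{R}^3\times\mathbb{R}^3\times\mathbb{R}_+.$$ $\|f(t)\|_{L^p}$ is taken over $(x,v)\in\mathbb{R}^3\times\mathbb{R}^3$: it is $\big(\int_{\mathbb{R}^6}|f(x,v,t)|^p\,dx\,dv\big)^{1/p}$ for $0<p<\infty$ (also when $p<1$, where it is only a quasi-norm), and the essential supremum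 for $p=\infty$. *)

theory Defs
  imports "HOL-Analysis.Analysis" "HOL-Probability.Essential_Supremum"
begin

type_synonym vec3 = "real ^ 3"

text \<open>Surface measure on the unit sphere, in polar-coordinate form: the surface measure of a Borel
  set \<open>A\<close> of unit vectors is three times the volume of the cone \<open>{r \<omega> | 0 < r < 1, \<omega> \<in> A}\<close>.
  Here \<open>sgn x = x / |x|\<close>. It is a measure on all Borel sets of space, carried by the sphere.\<close>

definition sphere_measure :: "vec3 measure" where
  "sphere_measure = distr (scale_measure 3 (restrict_space lborel (ball 0 1))) borel sgn"

lemma emeasure_sphere_measure_sphere: "emeasure sphere_measure (sphere 0 1) = ennreal (4 * pi)"
proof -
  let ?M = "scale_measure 3 (restrict_space lborel (ball (0::vec3) 1))"
  have sgn_meas: "sgn \<in> measurable ?M (borel :: vec3 measure)"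
  proof -
    have "sgn \<in> borel_measurable (borel :: vec3 measure)"
      unfolding sgn_div_norm by measurable
    then have "sgn \<in> borel_measurable (restrict_space lborel (ball (0::vec3) 1))"
      by (intro measurable_restrict_space1) simp
    moreover have "measurable ?M (borel :: vec3 measure)
        = measurable (restrict_space lborel (ball (0::vec3) 1)) borel"
      by (rule measurable_cong_sets) simp_all
    ultimately show ?thesis by simp
  qed
  have vimage: "sgn -` sphere 0 1 \<inter> space ?M = ball (0::vec3) 1 - {0}"
    by (auto simp: space_scale_measure space_restrict_space norm_sgn)
  have "emeasure sphere_measure (sphere 0 1) = emeasure ?M (ball (0::vec3) 1 - {0})"
    unfolding sphere_measure_def by (subst emeasure_distr[OF sgn_meas]) (simp_all add: vimage)
  also have "\<dots> = 3 * emeasure lborel (ball (0::vec3) 1 - {0})"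
    by (simp add: emeasure_restrict_space)
  also have "emeasure lborel (ball (0::vec3) 1 - {0}) = emeasure lborel (ball (0::vec3) 1)"
    by (rule emeasure_Diff_null_set) (auto intro: finite_imp_null_set_lborel)
  also have "\<dots> = ennreal (4 / 3 * pi)"
    by (simp add: emeasure_ball unit_ball_vol_3)
  also have "3 * ennreal (4 / 3 * pi) = ennreal (4 * pi)"
  proof -
    have "3 * ennreal (4 / 3 * pi) = ennreal 3 * ennreal (4 / 3 * pi)" by simp
    also have "\<dots> = ennreal (3 * (4 / 3 * pi))" by (rule ennreal_mult[symmetric]) simp_all
    finally show ?thesis by simp
  qed
  finally show ?thesis .
qed

definition hemisphere :: "vec3 \<Rightarrow> vec3 set" where
  "hemisphere u = {\<omega> \<in> sphere 0 1. 0 \<le> u \<bullet> \<omega>}"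

definition angle_between :: "vec3 \<Rightarrow> vec3 \<Rightarrow> real" where
  "angle_between u \<omega> = arccos ((u \<bullet> \<omega>) / (norm u * norm \<omega>))"

definition collision_kernel :: "real \<Rightarrow> (real \<Rightarrow> real) \<Rightarrow> vec3 \<Rightarrow> vec3 \<Rightarrow> real" where
  "collision_kernel \<gamma> b u \<omega> = norm u powr \<gamma> * b (angle_between u \<omega>)"

definition post_v :: "vec3 \<Rightarrow> vec3 \<Rightarrow> vec3 \<Rightarrow> vec3" where
  "post_v v w \<omega> = v - ((v - w) \<bullet> \<omega>) *\<^sub>R \<omega>"

definition post_w :: "vec3 \<Rightarrow> vec3 \<Rightarrow> vec3 \<Rightarrow> vec3" where
  "post_w v w \<omega> = w + ((v - w) \<bullet> \<omega>) *\<^sub>R \<omega>"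

text \<open>In the collision integral, \<open>w\<close> stands for \<open>v\<^sub>*\<close>. The product measure is completed because
  densities are only assumed Lebesgue measurable.\<close>

definition collision_measure :: "(vec3 \<times> vec3) measure" where
  "collision_measure = completion (lborel \<Otimes>\<^sub>M sphere_measure)"

definition collision_domain :: "vec3 \<Rightarrow> (vec3 \<times> vec3) set" where
  "collision_domain v = {(w, \<omega>). \<omega> \<in> hemisphere (v - w)}"

definition collision_integrand ::
    "(vec3 \<Rightarrow> vec3 \<Rightarrow> real) \<Rightarrow> (vec3 \<Rightarrow> vec3 \<Rightarrow> real \<Rightarrow> real) \<Rightarrow> vec3 \<Rightarrow> vec3 \<Rightarrow> real
      \<Rightarrow> vec3 \<times> vec3 \<Rightarrow> real" where
  "collision_integrand B f x v t =
     (\<lambda>(w, \<omega>). B (v - w) \<omega> *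
        (f x (post_v v w \<omega>) t * f x (post_w v w \<omega>) t - f x v t * f x w t))"

definition collision_integral_exists ::
    "(vec3 \<Rightarrow> vec3 \<Rightarrow> real) \<Rightarrow> (vec3 \<Rightarrow> vec3 \<Rightarrow> real \<Rightarrow> real) \<Rightarrow> vec3 \<Rightarrow> vec3 \<Rightarrow> real \<Rightarrow> bool" where
  "collision_integral_exists B f x v t \<longleftrightarrow>
     set_integrable collision_measure (collision_domain v) (collision_integrand B f x v t)"

definition collision_operator ::
    "real \<Rightarrow> (vec3 \<Rightarrow> vec3 \<Rightarrow> real) \<Rightarrow> (vec3 \<Rightarrow> vec3 \<Rightarrow> real \<Rightarrow> real)
      \<Rightarrow> vec3 \<Rightarrow> vec3 \<Rightarrow> real \<Rightarrow> real" where
  "collision_operator \<kappa> B f x v t =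
     (1 / \<kappa>) * set_lebesgue_integral collision_measure (collision_domain v)
                 (collision_integrand B f x v t)"

definition sharp :: "(vec3 \<Rightarrow> vec3 \<Rightarrow> real \<Rightarrow> 'a) \<Rightarrow> vec3 \<Rightarrow> vec3 \<Rightarrow> real \<Rightarrow> 'a" where
  "sharp h x v t = h (x + t *\<^sub>R v) v t"

text \<open>Membership in \<open>L\<^sup>\<infinity>(0,T; L\<^sup>1)\<close>; strong measurability of \<open>t \<mapsto> f(t)\<close> with values in \<open>L\<^sup>1\<close> is
  expressed as joint Lebesgue measurability.\<close>

definition in_Linfty_L1 :: "real \<Rightarrow> (vec3 \<Rightarrow> vec3 \<Rightarrow> real \<Rightarrow> real) \<Rightarrow> bool" where
  "in_Linfty_L1 T f \<longleftrightarrow>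
     (\<lambda>(x, v, t). f x v t) \<in> borel_measurable (lebesgue_on (UNIV \<times> UNIV \<times> {0<..<T})) \<and>
     (\<exists>C. AE t in lebesgue_on {0<..<T}.
        integrable lebesgue (\<lambda>(x, v). f x v t) \<and> (LINT (x, v)|lebesgue. \<bar>f x v t\<bar>) \<le> C)"

text \<open>As usual for elements of \<open>L\<^sup>1\<close>, at each time the relations between functions are understood
  up to null sets of positions and velocities. Existence of the collision integral and of the time
  integral is part of the meaning of the mild equation; it has to be stated because Isabelle's
  integral is 0 on non-integrable functions.\<close>

definition mild_solution ::
    "real \<Rightarrow> (vec3 \<Rightarrow> vec3 \<Rightarrow> real) \<Rightarrow> (vec3 \<Rightarrow> vec3 \<Rightarrow> real)
      \<Rightarrow> (vec3 \<Rightarrow> vec3 \<Rightarrow> real \<Rightarrow> real) \<Rightarrow> bool" where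
  "mild_solution \<kappa> B f0 f \<longleftrightarrow>
     (\<forall>t\<ge>0. (\<lambda>(x, v). f x v t) \<in> borel_measurable lebesgue) \<and>
     (\<forall>t\<ge>0. AE (x, v) in lebesgue. 0 \<le> f x v t) \<and>
     (\<forall>T>0. in_Linfty_L1 T f) \<and>
     (\<forall>t\<ge>0. AE (x, v) in lebesgue.
        (AE s in lebesgue_on {0..t}. sharp (collision_integral_exists B f) x v s) \<and>
        set_integrable lebesgue {0..t} (\<lambda>s. sharp (collision_operator \<kappa> B f) x v s) \<and>
        sharp f x v t = f0 x v + (LINT s:{0..t}|lebesgue. sharp (collision_operator \<kappa> B f) x v s))"

text \<open>The \<open>L\<^sup>p\<close> (quasi-)norm over phase space for \<open>0 < p \<le> \<infinity>\<close>, with values in \<open>[0,\<infinity>]\<close>.\<close>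

definition Lp_norm :: "ennreal \<Rightarrow> (vec3 \<Rightarrow> vec3 \<Rightarrow> real) \<Rightarrow> ennreal" where
  "Lp_norm p g =
     (if p = \<infinity> then esssup lebesgue (\<lambda>(x, v). ennreal \<bar>g x v\<bar>)
      else (let I = (\<integral>\<^sup>+ (x, v). ennreal (\<bar>g x v\<bar> powr enn2real p) \<partial>lebesgue)
            in if I = \<infinity> then \<infinity> else ennreal (enn2real I powr (1 / enn2real p))))"

end

theory Submission
  imports Defs
begin

text \<open>
  At time \<open>0\<close> the time integral in the mild equation runs over a single point, so \<open>f\<close> at time
  \<open>0\<close> equals the initial datum almost everywhere, and the lower barrier at time \<open>0\<close> is a lower
  bound for the datum. Since the same Gaussian bounds \<open>f(x + tv, v, t)\<close> from above at every later
  time, the solution, followed along the free flow, satisfies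
  \<open>f(x + tv, v, t) \<le> (a\<^sub>M / a\<^sub>m) f\<^sub>0(x, v)\<close> almost everywhere. The free flow \<open>(x, v) \<mapsto> (x + tv, v)\<close>
  is a shear, so it preserves Lebesgue measure and with it every \<open>L\<^sup>p\<close> quasi-norm. Hence
  \<open>G = a\<^sub>M / a\<^sub>m\<close> works for all \<open>p\<close> simultaneously.

  The free flow is treated in \<open>distr_lebesgue_free_flow\<close> and \<open>Lp_norm_free_flow\<close>, the
  passage from a pointwise to a norm inequality in \<open>Lp_norm_le_mult\<close>, and the comparison
  with the datum in \<open>mild_solution_initial\<close> and \<open>mild_solution_le_initial\<close>.
\<close>

section \<open>Free flow on phase space\<close>

definition free_flow :: "real \<Rightarrow> 'a \<times> 'a \<Rightarrow> 'a \<times> 'a::real_vector" where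
  "free_flow t = (\<lambda>(x, v). (x + t *\<^sub>R v, v))"

lemma free_flow_inverse: "free_flow t (free_flow (- t) z) = z"
  by (cases z) (simp add: free_flow_def)

lemma borel_measurable_free_flow [measurable]:
  "free_flow t \<in> borel_measurable (borel :: ('a \<times> 'a::euclidean_space) measure)"
  unfolding free_flow_def split_beta
  by (intro borel_measurable_continuous_onI continuous_intros)

text \<open>By Tonelli the position integral may be taken first, and for fixed velocity the flow
  translates the position.\<close>

lemma distr_lborel_free_flow:
  "distr lborel borel (free_flow t) = (lborel :: ('a \<times> 'a::euclidean_space) measure)"
proof (rule measure_eqI)
  fix A :: "('a \<times> 'a) set"
  assume "A \<in> sets (distr lborel borel (free_flow t))"
  then have A [measurable]: "A \<in> sets borel" by simp
  have A_pair: "indicator A \<in> borel_measurable (lborel \<Otimes>\<^sub>M (lborel :: 'a measure))"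
    unfolding lborel_prod by simp
  have flow_pair: "(\<lambda>z. indicator A (free_flow t z))
      \<in> borel_measurable (lborel \<Otimes>\<^sub>M (lborel :: 'a measure))"
    unfolding lborel_prod by simp
  have translate: "(\<integral>\<^sup>+ x. indicator A (x + t *\<^sub>R v, v) \<partial>lborel)
      = (\<integral>\<^sup>+ x. indicator A (x, v) \<partial>lborel)" for v :: 'a
  proof -
    have "(\<integral>\<^sup>+ x. indicator A (x, v) \<partial>lborel)
        = (\<integral>\<^sup>+ x. indicator A (x, v) \<partial>distr lborel borel ((+) (t *\<^sub>R v)))"
      by (simp add: lborel_distr_plus)
    also have "\<dots> = (\<integral>\<^sup>+ x. indicator A (x + t *\<^sub>R v, v) \<partial>lborel)"
      by (subst nn_integral_distr) (simp_all add: add.commute)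
    finally show ?thesis ..
  qed
  have "emeasure (distr lborel borel (free_flow t)) A
      = (\<integral>\<^sup>+ z. indicator A z \<partial>distr lborel borel (free_flow t))"
    by simp
  also have "\<dots> = (\<integral>\<^sup>+ z. indicator A (free_flow t z) \<partial>(lborel \<Otimes>\<^sub>M lborel))"
    by (subst nn_integral_distr) (simp_all add: lborel_prod)
  also have "\<dots> = (\<integral>\<^sup>+ v. \<integral>\<^sup>+ x. indicator A (x + t *\<^sub>R v, v) \<partial>lborel \<partial>lborel)"
    by (subst lborel_pair.nn_integral_snd[OF flow_pair, symmetric]) (simp add: free_flow_def)
  also have "\<dots> = (\<integral>\<^sup>+ v. \<integral>\<^sup>+ x. indicator A (x, v) \<partial>lborel \<partial>lborel)"
    by (simp only: translate)
  also have "\<dots> = (\<integral>\<^sup>+ z. indicator A z \<partial>(lborel \<Otimes>\<^sub>M lborel))"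
    by (rule lborel_pair.nn_integral_snd[OF A_pair])
  also have "\<dots> = emeasure lborel A"
    by (simp add: lborel_prod)
  finally show "emeasure (distr lborel borel (free_flow t)) A = emeasure lborel A" .
qed simp

lemma distr_lebesgue_lborel_free_flow:
  "distr lebesgue lborel (free_flow t) = (lborel :: ('a \<times> 'a::euclidean_space) measure)"
proof -
  have "distr lebesgue lborel (free_flow t)
      = distr lborel (lborel :: ('a \<times> 'a) measure) (free_flow t)"
    by (rule distr_completion) simp
  also have "\<dots> = distr lborel borel (free_flow t)"
    by (rule distr_cong) simp_all
  finally show ?thesis
    by (simp only: distr_lborel_free_flow)
qed

lemma measurable_lebesgue_free_flow [measurable]:
  "free_flow t \<in> measurable lebesgue (lebesgue :: ('a \<times> 'a::euclidean_space) measure)"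
  by (rule completion.measurable_completion2)
    (simp_all add: distr_lebesgue_lborel_free_flow measurable_completion)

lemma distr_lebesgue_free_flow:
  "distr lebesgue lebesgue (free_flow t) = (lebesgue :: ('a \<times> 'a::euclidean_space) measure)"
  using completion.completion_distr_eq[of "free_flow t" lborel "lborel :: ('a \<times> 'a) measure"]
  by (simp add: distr_lebesgue_lborel_free_flow measurable_completion)

lemma AE_lebesgue_free_flow_iff:
  fixes P :: "'a \<times> 'a::euclidean_space \<Rightarrow> bool"
  shows "(AE z in lebesgue. P (free_flow t z)) \<longleftrightarrow> (AE z in lebesgue. P z)"
proof -
  have push: "AE z in lebesgue. Q (free_flow s z)" if "AE z in lebesgue. Q z"
    for Q :: "'a \<times> 'a \<Rightarrow> bool" and s
    using that by (intro AE_distrD[OF measurable_lebesgue_free_flow])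
      (simp only: distr_lebesgue_free_flow)
  show ?thesis
    using push[of P t] push[of "\<lambda>z. P (free_flow t z)" "- t"]
    unfolding free_flow_inverse by blast
qed

lemma borel_measurable_sharp:
  assumes "(\<lambda>(x, v). f x v t) \<in> borel_measurable lebesgue"
  shows "(\<lambda>(x, v). sharp f x v t) \<in> borel_measurable lebesgue"
proof -
  have "(\<lambda>z. (\<lambda>(x, v). f x v t) (free_flow t z)) \<in> borel_measurable lebesgue"
    using measurable_compose[OF measurable_lebesgue_free_flow assms] .
  then show ?thesis
    by (simp add: free_flow_def sharp_def split_beta)
qed

section \<open>Phase-space quasi-norms\<close>

text \<open>The quasi-norm sees \<open>f\<close> only through \<open>\<phi> \<circ> f\<close> with \<open>\<phi>(y) = |y|\<^sup>p\<close> or \<open>\<phi>(y) = |y|\<close>; passing to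
  \<open>sharp f\<close> composes this with the free flow, which changes neither integrals nor
  almost-everywhere bounds.\<close>

lemma Lp_norm_free_flow:
  assumes f: "(\<lambda>(x, v). f x v t) \<in> borel_measurable lebesgue"
  shows "Lp_norm p (\<lambda>x v. sharp f x v t) = Lp_norm p (\<lambda>x v. f x v t)"
proof -
  note f' = borel_measurable_sharp[of f t, OF f]
  have flow: "(\<lambda>(x, v). \<phi> (sharp f x v t)) = (\<lambda>z. (\<lambda>(x, v). \<phi> (f x v t)) (free_flow t z))"
    for \<phi> :: "real \<Rightarrow> ennreal"
    by (auto simp: free_flow_def sharp_def)
  have meas: "(\<lambda>(x, v). \<phi> (f x v t)) \<in> borel_measurable lebesgue"
    "(\<lambda>(x, v). \<phi> (sharp f x v t)) \<in> borel_measurable lebesgue"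
    if "\<phi> \<in> borel_measurable borel" for \<phi> :: "real \<Rightarrow> ennreal"
    using measurable_compose[OF f that] measurable_compose[OF f' that] by (simp_all add: split_beta)
  have "(\<integral>\<^sup>+ (x, v). \<phi> (sharp f x v t) \<partial>lebesgue) = (\<integral>\<^sup>+ (x, v). \<phi> (f x v t) \<partial>lebesgue)"
    if "\<phi> \<in> borel_measurable borel" for \<phi> :: "real \<Rightarrow> ennreal"
    using nn_integral_distr[OF measurable_lebesgue_free_flow, of "\<lambda>(x, v). \<phi> (f x v t)" t] meas(1)[OF that]
    unfolding flow[of \<phi>] by (simp add: distr_lebesgue_free_flow)
  from this[of "\<lambda>y. ennreal (\<bar>y\<bar> powr enn2real p)"]
  have "(\<integral>\<^sup>+ (x, v). ennreal (\<bar>sharp f x v t\<bar> powr enn2real p) \<partial>lebesgue)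
      = (\<integral>\<^sup>+ (x, v). ennreal (\<bar>f x v t\<bar> powr enn2real p) \<partial>lebesgue)"
    by simp
  moreover have "esssup lebesgue (\<lambda>(x, v). ennreal \<bar>sharp f x v t\<bar>)
      = esssup lebesgue (\<lambda>(x, v). ennreal \<bar>f x v t\<bar>)"
  proof -
    have abs: "(\<lambda>y. ennreal \<bar>y\<bar>) \<in> borel_measurable (borel :: real measure)" by simp
    show ?thesis
      unfolding esssup_eq_AE[OF meas(1)[OF abs]] esssup_eq_AE[OF meas(2)[OF abs]]
      unfolding flow[of "\<lambda>y. ennreal \<bar>y\<bar>"]
      using AE_lebesgue_free_flow_iff[of "\<lambda>z. (case z of (x, v) \<Rightarrow> ennreal \<bar>f x v t\<bar>) \<le> _" t]
      by simp
  qed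
  ultimately show ?thesis
    by (simp add: Lp_norm_def)
qed

text \<open>For finite exponent \<open>q\<close> the inequality is integrated in the form \<open>C\<^sup>-\<^sup>q |g|\<^sup>q \<le> |h|\<^sup>q\<close>: pulling the
  constant out of the integral uses measurability of the function next to it, so it stands with \<open>g\<close>.\<close>

lemma Lp_norm_le_mult:
  assumes p: "0 < p" and C: "0 < C"
    and g: "(\<lambda>(x, v). g x v) \<in> borel_measurable lebesgue"
    and le: "AE (x, v) in lebesgue. \<bar>g x v\<bar> \<le> C * \<bar>h x v\<bar>"
  shows "Lp_norm p g \<le> ennreal C * Lp_norm p h"
proof (cases "p = \<infinity>")
  case True
  let ?K = "esssup lebesgue (\<lambda>(x, v). ennreal \<bar>h x v\<bar>)"
  have "(\<lambda>(x, v). ennreal \<bar>g x v\<bar>) \<in> borel_measurable lebesgue"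
    using measurable_compose[OF g, of "\<lambda>y. ennreal \<bar>y\<bar>" borel] by (simp add: split_beta)
  moreover have "AE z in lebesgue. (case z of (x, v) \<Rightarrow> ennreal \<bar>g x v\<bar>) \<le> ennreal C * ?K"
    using le esssup_AE[of "\<lambda>(x, v). ennreal \<bar>h x v\<bar>" lebesgue]
  proof eventually_elim
    case (elim z)
    obtain x v where z: "z = (x, v)" by (cases z)
    have "ennreal \<bar>g x v\<bar> \<le> ennreal (C * \<bar>h x v\<bar>)"
      using elim(1) by (intro ennreal_leI) (simp add: z)
    also have "\<dots> = ennreal C * ennreal \<bar>h x v\<bar>"
      using C by (simp add: ennreal_mult)
    also have "\<dots> \<le> ennreal C * ?K"
      using elim(2) by (intro mult_left_mono) (simp_all add: z)
    finally show ?case by (simp add: z)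
  qed
  ultimately have "esssup lebesgue (\<lambda>(x, v). ennreal \<bar>g x v\<bar>) \<le> ennreal C * ?K"
    by (rule esssup_I)
  then show ?thesis
    by (simp add: Lp_norm_def True)
next
  case False
  define q where "q = enn2real p"
  have q: "0 < q"
    using p False by (simp add: q_def enn2real_positive_iff less_top)
  define I J where "I = (\<integral>\<^sup>+ (x, v). ennreal (\<bar>g x v\<bar> powr q) \<partial>lebesgue)"
    and "J = (\<integral>\<^sup>+ (x, v). ennreal (\<bar>h x v\<bar> powr q) \<partial>lebesgue)"
  have norms: "Lp_norm p g = (if I = \<infinity> then \<infinity> else ennreal (enn2real I powr (1 / q)))"
    "Lp_norm p h = (if J = \<infinity> then \<infinity> else ennreal (enn2real J powr (1 / q)))"
    using False by (simp_all add: Lp_norm_def Let_def I_def J_def q_def)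
  have "ennreal (C powr - q) * I
      = (\<integral>\<^sup>+ z. ennreal (C powr - q) * (case z of (x, v) \<Rightarrow> ennreal (\<bar>g x v\<bar> powr q)) \<partial>lebesgue)"
    unfolding I_def using measurable_compose[OF g, of "\<lambda>y. ennreal (\<bar>y\<bar> powr q)" borel]
    by (intro nn_integral_cmult[symmetric]) (simp add: split_beta)
  also have "\<dots> \<le> J"
    unfolding J_def
  proof (rule nn_integral_mono_AE)
    show "AE z in lebesgue. ennreal (C powr - q) * (case z of (x, v) \<Rightarrow> ennreal (\<bar>g x v\<bar> powr q))
        \<le> (case z of (x, v) \<Rightarrow> ennreal (\<bar>h x v\<bar> powr q))"
      using le
    proof eventually_elim
      case (elim z)
      obtain x v where z: "z = (x, v)" by (cases z)
      have "\<bar>g x v\<bar> powr q \<le> (C * \<bar>h x v\<bar>) powr q"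
        using elim q by (intro powr_mono2) (simp_all add: z)
      also have "\<dots> = C powr q * \<bar>h x v\<bar> powr q"
        using C by (simp add: powr_mult)
      finally have "C powr - q * \<bar>g x v\<bar> powr q \<le> \<bar>h x v\<bar> powr q"
        using C by (simp add: powr_minus field_simps)
      then show ?case
        by (simp add: z ennreal_mult[symmetric] ennreal_leI)
    qed
  qed
  finally have IJ: "ennreal (C powr - q) * I \<le> J" .
  show ?thesis
  proof (cases "J = \<infinity>")
    case True
    then show ?thesis using C by (simp add: norms ennreal_mult_top)
  next
    case J: False
    have I: "I \<noteq> \<infinity>"
      using IJ J C by (auto simp: ennreal_mult_top top_unique)
    have "C powr - q * enn2real I \<le> enn2real J"
      using enn2real_mono[OF IJ] J by (simp add: enn2real_mult less_top)
    then have "enn2real I \<le> C powr q * enn2real J"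
      using C by (simp add: powr_minus field_simps)
    then have "enn2real I powr (1 / q) \<le> (C powr q * enn2real J) powr (1 / q)"
      using q by (intro powr_mono2) simp_all
    also have "\<dots> = C * enn2real J powr (1 / q)"
      using C q by (simp add: powr_mult powr_powr)
    finally show ?thesis
      using I J C by (simp add: norms ennreal_mult[symmetric] ennreal_leI)
  qed
qed

section \<open>Comparison of mild solutions with their initial data\<close>

lemma mild_solution_initial:
  assumes "mild_solution \<kappa> B f0 f"
  shows "AE (x, v) in lebesgue. f x v 0 = f0 x v"
proof -
  have point: "(LINT s:{0..0}|lebesgue. q s) = 0" for q :: "real \<Rightarrow> real"
  proof -
    have "AE s in lebesgue. s \<noteq> (0::real)"
      by (intro AE_completion AE_lborel_singleton)
    then show ?thesis
      unfolding set_lebesgue_integral_def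
      by (intro integral_eq_zero_AE) auto
  qed
  have "AE (x, v) in lebesgue.
      sharp f x v 0 = f0 x v + (LINT s:{0..0}|lebesgue. sharp (collision_operator \<kappa> B f) x v s)"
  proof -
    have "AE (x, v) in lebesgue.
        (AE s in lebesgue_on {0..0}. sharp (collision_integral_exists B f) x v s) \<and>
        set_integrable lebesgue {0..0} (\<lambda>s. sharp (collision_operator \<kappa> B f) x v s) \<and>
        sharp f x v 0 = f0 x v + (LINT s:{0..0}|lebesgue. sharp (collision_operator \<kappa> B f) x v s)"
      using assms unfolding mild_solution_def by blast
    then show ?thesis
      by eventually_elim auto
  qed
  then show ?thesis
    unfolding point by (simp add: sharp_def)
qed

text \<open>The barrier profile \<open>M\<close> is eliminated between the upper bound at time \<open>t\<close> and the lower bound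
  at time \<open>0\<close>, when the solution agrees with the datum almost everywhere.\<close>

lemma mild_solution_le_initial:
  assumes f: "mild_solution \<kappa> B f0 f"
    and a: "0 < a\<^sub>m" "0 < a\<^sub>M" and t: "0 \<le> t" and M: "\<And>x v. 0 \<le> M x v"
    and barrier: "\<And>s. 0 \<le> s \<Longrightarrow>
      AE (x, v) in lebesgue. a\<^sub>m * M x v \<le> sharp f x v s \<and> sharp f x v s \<le> a\<^sub>M * M x v"
  shows "AE (x, v) in lebesgue. \<bar>sharp f x v t\<bar> \<le> a\<^sub>M / a\<^sub>m * \<bar>f0 x v\<bar>"
  using mild_solution_initial[OF f] barrier[OF order_refl] barrier[OF t]
proof eventually_elim
  case (elim z)
  obtain x v where z: "z = (x, v)" by (cases z)
  have "0 \<le> a\<^sub>m * M x v"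
    using a M by simp
  then have "0 \<le> sharp f x v t"
    using elim(3) by (simp add: z)
  then have "\<bar>sharp f x v t\<bar> \<le> a\<^sub>M * M x v"
    using elim(3) by (simp add: z)
  also have "\<dots> = a\<^sub>M / a\<^sub>m * (a\<^sub>m * M x v)"
    using a by simp
  also have "\<dots> \<le> a\<^sub>M / a\<^sub>m * \<bar>f0 x v\<bar>"
  proof (rule mult_left_mono)
    have "a\<^sub>m * M x v \<le> f0 x v"
      using elim(1,2) by (simp add: z sharp_def)
    then show "a\<^sub>m * M x v \<le> \<bar>f0 x v\<bar>"
      using abs_ge_self order_trans by blast
  qed (use a in simp)
  finally show ?case by (simp add: z)
qed

theorem theorem1p1:
  fixes \<kappa> \<gamma> \<alpha> \<beta> a\<^sub>m a\<^sub>M B\<^sub>\<gamma> :: real and b :: "real \<Rightarrow> real" and p :: ennreal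
  assumes "0 < \<kappa>" and "-3 < \<gamma>" and "\<gamma> \<le> 1"
    and "\<And>\<theta>. 0 \<le> \<theta> \<Longrightarrow> \<theta> \<le> pi / 2 \<Longrightarrow> 0 \<le> b \<theta>"
    and "\<And>u. u \<noteq> 0 \<Longrightarrow>
           set_integrable (completion sphere_measure) (hemisphere u) (\<lambda>\<omega>. b (angle_between u \<omega>))"
    and "\<And>u. u \<noteq> 0 \<Longrightarrow>
           (LINT \<omega>:hemisphere u|completion sphere_measure. b (angle_between u \<omega>)) = B\<^sub>\<gamma>"
    and "0 < \<alpha>" and "0 < \<beta>" and "0 < a\<^sub>m" and "0 < a\<^sub>M"
    and "0 < p"
  shows "\<exists>G::real. 0 \<le> G \<and>
    (\<forall>(f0 :: vec3 \<Rightarrow> vec3 \<Rightarrow> real) (f :: vec3 \<Rightarrow> vec3 \<Rightarrow> real \<Rightarrow> real).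
      mild_solution \<kappa> (collision_kernel \<gamma> b) f0 f \<longrightarrow>
      (\<forall>t\<ge>0. AE (x, v) in lebesgue.
         a\<^sub>m * exp (- \<alpha> * (norm x)\<^sup>2 - \<beta> * (norm v)\<^sup>2) \<le> f (x + t *\<^sub>R v) v t \<and>
         f (x + t *\<^sub>R v) v t \<le> a\<^sub>M * exp (- \<alpha> * (norm x)\<^sup>2 - \<beta> * (norm v)\<^sup>2)) \<longrightarrow>
      (\<forall>t\<ge>0. Lp_norm p (\<lambda>x v. f x v t) \<le> ennreal G * Lp_norm p f0))"
proof (intro exI[of _ "a\<^sub>M / a\<^sub>m"] conjI allI impI)
  show "0 \<le> a\<^sub>M / a\<^sub>m"
    using assms by simp
next
  fix f0 :: "vec3 \<Rightarrow> vec3 \<Rightarrow> real" and f :: "vec3 \<Rightarrow> vec3 \<Rightarrow> real \<Rightarrow> real" and t :: real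
  assume f: "mild_solution \<kappa> (collision_kernel \<gamma> b) f0 f" and t: "0 \<le> t"
    and barrier: "\<forall>t\<ge>0. AE (x, v) in lebesgue.
         a\<^sub>m * exp (- \<alpha> * (norm x)\<^sup>2 - \<beta> * (norm v)\<^sup>2) \<le> f (x + t *\<^sub>R v) v t \<and>
         f (x + t *\<^sub>R v) v t \<le> a\<^sub>M * exp (- \<alpha> * (norm x)\<^sup>2 - \<beta> * (norm v)\<^sup>2)"
  have meas: "(\<lambda>(x, v). f x v t) \<in> borel_measurable lebesgue"
    using f t by (simp add: mild_solution_def)
  have "AE (x, v) in lebesgue. \<bar>sharp f x v t\<bar> \<le> a\<^sub>M / a\<^sub>m * \<bar>f0 x v\<bar>"
    using barrier
    by (intro mild_solution_le_initial[OF f \<open>0 < a\<^sub>m\<close> \<open>0 < a\<^sub>M\<close> t,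
          where M = "\<lambda>x v. exp (- \<alpha> * (norm x)\<^sup>2 - \<beta> * (norm v)\<^sup>2)"])
      (simp_all add: sharp_def)
  then have "Lp_norm p (\<lambda>x v. sharp f x v t) \<le> ennreal (a\<^sub>M / a\<^sub>m) * Lp_norm p f0"
    using assms by (intro Lp_norm_le_mult borel_measurable_sharp meas) simp_all
  then show "Lp_norm p (\<lambda>x v. f x v t) \<le> ennreal (a\<^sub>M / a\<^sub>m) * Lp_norm p f0"
    by (simp only: Lp_norm_free_flow[of f t, OF meas])
qed

end
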